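(* Let $n\geq 2$, let $\sigma=\{v_0,\dots,v_n\}\subseteq\mathbb{R}^n$ be a non-degenerate $n$-dimensional simplex, let $0\leq k\leq n-1$, and let $\tau=\{v_0,\dots,v_k\}$ and $\tau^*=\sigma\setminus\tau=\{v_{k+1},\dots,v_n\}$. Let $$\mathcal{V}_{\tau}=\mathrm{span}\{v_1-v_0,\dots,v_k-v_0\},\qquad \mathcal{V}_{\tau^*}=\mathrm{span}\{v_{k+1}-v_n,\dots,v_{n-1}-v_n\}$$ be the vector spaces parallel to the affine hulls of $\tau$ and $\tau^*$, respectively, and let $\mathcal{L}=(\mathcal{V}_{\tau}+\mathcal{V}_{\tau^*})^{\perp}\subseteq\mathbb{R}^n$ be the (one-dimensional) orthogonal complement of their sum in $\mathbb{R}^n$. Then for every non-zero vector $w\in\mathcal{L}$, $$\mathrm{alt}(\tau,\tau^* )=\left|\left\langle v_0-v_n,\frac{w}{\|w\|}\right\rangle\right|.$$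
   Context: $\mathbb{R}^n$ carries the standard Euclidean inner product $\langle\cdot,\cdot\rangle$ and norm $\|\cdot\|$. A simplex is identified with its set of vertices; $\sigma=\{v_0,\dots,v_n\}\subseteq\mathbb{R}^n$ is non-degenerate if its vertices are affinely independent. The span of an empty set of vectors is $\{0\}$ (this occurs for $\mathcal{V}_\tau$ when $k=0$ and for $\mathcal{V}_{\tau^*}$ when $k=n-1$). Let $\mathcal{F}_\tau$ and $\mathcal{F}_{\tau^*}$ denote the affine hulls of $\tau$ and $\tau^*$. The (generalized) altitude of $\tau$ and $\tau^*$ is the smallest distance between these affine hulls: $$\mathrm{alt}(\tau,\tau^* )=\min_{u\in\mathcal{F}_\tau,\;u^*\in\mathcal{F}_{\tau^*}}\|u-u^*\|.$$ *)

theory Defs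
  imports "HOL-Analysis.Analysis"
begin

definition alt :: "'a::euclidean_space set \<Rightarrow> 'a set \<Rightarrow> real" where
  "alt S T = (LEAST d. \<exists>u \<in> affine hull S. \<exists>u' \<in> affine hull T. d = norm (u - u'))"

text \<open>
  \<open>LEAST\<close> is meaningful on the reals only when the minimum is attained; for affine hulls of
  nonempty sets it always is.
\<close>

lemma alt_is_minimum:
  fixes S T :: "'a::euclidean_space set"
  assumes "S \<noteq> {}" "T \<noteq> {}"
  shows "\<exists>u \<in> affine hull S. \<exists>u' \<in> affine hull T. alt S T = norm (u - u')"
    and "\<lbrakk>u \<in> affine hull S; u' \<in> affine hull T\<rbrakk> \<Longrightarrow> alt S T \<le> norm (u - u')"
proof -
  let ?D = "{x - y |x y. x \<in> affine hull S \<and> y \<in> affine hull T}"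
  have "affine ?D"
  proof (rule affine_def[THEN iffD2], intro ballI allI impI)
    fix p q :: 'a and a b :: real
    assume "p \<in> ?D" "q \<in> ?D" and ab: "a + b = 1"
    then obtain x y x' y' where xy: "p = x - y" "q = x' - y'"
      "x \<in> affine hull S" "y \<in> affine hull T" "x' \<in> affine hull S" "y' \<in> affine hull T"
      by blast
    have "a *\<^sub>R x + b *\<^sub>R x' \<in> affine hull S" "a *\<^sub>R y + b *\<^sub>R y' \<in> affine hull T"
      using xy ab by (auto intro: mem_affine[OF affine_affine_hull])
    moreover have "a *\<^sub>R p + b *\<^sub>R q = (a *\<^sub>R x + b *\<^sub>R x') - (a *\<^sub>R y + b *\<^sub>R y')"
      by (simp add: xy algebra_simps)
    ultimately show "a *\<^sub>R p + b *\<^sub>R q \<in> ?D"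
      by blast
  qed
  then have "closed ?D"
    by (rule affine_closed)
  moreover have "?D \<noteq> {}"
    using assms hull_subset[of S affine] hull_subset[of T affine] by blast
  ultimately obtain z where z: "z \<in> ?D" "\<And>y. y \<in> ?D \<Longrightarrow> dist 0 z \<le> dist 0 y"
    by (metis (no_types, lifting) distance_attains_inf)
  have eq: "alt S T = norm z"
    unfolding alt_def
  proof (rule Least_equality)
    show "\<exists>u \<in> affine hull S. \<exists>u' \<in> affine hull T. norm z = norm (u - u')"
      using z(1) by auto
  next
    fix d assume "\<exists>u \<in> affine hull S. \<exists>u' \<in> affine hull T. d = norm (u - u')"
    then obtain u u' where "u \<in> affine hull S" "u' \<in> affine hull T" "d = norm (u - u')"
      by auto
    then show "norm z \<le> d"
      using z(2)[of "u - u'"] by auto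
  qed
  show "\<exists>u \<in> affine hull S. \<exists>u' \<in> affine hull T. alt S T = norm (u - u')"
    using z(1) eq by auto
  show "\<lbrakk>u \<in> affine hull S; u' \<in> affine hull T\<rbrakk> \<Longrightarrow> alt S T \<le> norm (u - u')"
    using z(2)[of "u - u'"] eq by auto
qed

lemma dim_orthogonal_comp_opposite_faces:
  fixes v :: "nat \<Rightarrow> real ^ 'n" and n k :: nat
  assumes n: "n = CARD('n)" and inj: "inj_on v {0..n}"
    and indep: "\<not> affine_dependent (v ` {0..n})" and k: "k \<le> n - 1"
  shows "dim ((span {v i - v 0 |i. i \<in> {1..k}} + span {v i - v n |i. i \<in> {k+1..n-1}})\<^sup>\<bottom>) = 1"
proof -
  let ?A = "{v i - v 0 |i. i \<in> {1..k}}" and ?B = "{v i - v n |i. i \<in> {k+1..n-1}}"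
  have n1: "n \<ge> 1" unfolding n by (simp add: Suc_leI)
  have A: "?A = (\<lambda>i. v i - v 0) ` {1..k}" and B: "?B = (\<lambda>i. v i - v n) ` {k+1..n-1}"
    by auto
  have sum: "span ?A + span ?B = span (?A \<union> ?B)"
    unfolding span_Un set_plus_def by auto
  have fin: "finite (?A \<union> ?B)"
    unfolding A B by simp
  have "card (?A \<union> ?B) \<le> card ?A + card ?B"
    by (rule card_Un_le)
  also have "\<dots> \<le> k + (n - 1 - k)"
  proof (rule add_mono)
    show "card ?A \<le> k"
      unfolding A using card_image_le[of "{1..k}" "\<lambda>i. v i - v 0"] by simp
    show "card ?B \<le> n - 1 - k"
      unfolding B using card_image_le[of "{k+1..n-1}" "\<lambda>i. v i - v n"] by simp
  qed
  finally have le: "dim (?A \<union> ?B) \<le> n - 1"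
    using dim_le_card[OF span_superset fin] k by linarith
  have "aff_dim (v ` {0..n}) = int n"
    using aff_dim_affine_independent[OF indep] card_image[OF inj] by simp
  moreover have "aff_dim (v ` {0..n}) = int (dim ((\<lambda>x. x - v n) ` v ` {0..n}))"
    by (rule aff_dim_eq_dim_subtract) (simp add: hull_inc)
  ultimately have dn: "dim ((\<lambda>x. x - v n) ` v ` {0..n}) = n"
    by simp
  have sub: "(\<lambda>x. x - v n) ` v ` {0..n} \<subseteq> span (insert (v 0 - v n) (?A \<union> ?B))"
  proof clarify
    fix i assume i: "i \<in> {0..n}"
    let ?S = "span (insert (v 0 - v n) (?A \<union> ?B))"
    consider "i = 0" | "i \<in> {1..k}" | "i \<in> {k+1..n-1}" | "i = n"
      using i by fastforce
    then show "v i - v n \<in> ?S"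
    proof cases
      case 2
      then have "(v i - v 0) + (v 0 - v n) \<in> ?S"
        by (intro span_add span_base) auto
      then show ?thesis by simp
    qed (auto intro: span_base span_zero)
  qed
  have "n \<le> dim (insert (v 0 - v n) (?A \<union> ?B))"
    using dim_mono[OF sub] dn by simp
  also have "\<dots> \<le> dim (?A \<union> ?B) + 1"
    by (simp add: dim_insert)
  finally have dimAB: "dim (span (?A \<union> ?B)) = n - 1"
    using le n1 by simp
  have "dim {y \<in> UNIV. \<forall>x \<in> span (?A \<union> ?B). orthogonal x y} + dim (span (?A \<union> ?B))
      = dim (UNIV :: (real ^ 'n) set)"
    by (rule dim_subspace_orthogonal_to_vectors) auto
  then have "dim ((span (?A \<union> ?B))\<^sup>\<bottom>) + (n - 1) = n"
    unfolding orthogonal_comp_def dimAB by (simp add: n)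
  then show ?thesis
    unfolding sum using n1 by linarith
qed

end

theory Submission
  imports Defs
begin

text \<open>
  Translating a point of one affine hull within its direction space changes the difference only
  by vectors orthogonal to \<open>w\<close>, so every difference has the same component along \<open>w\<close>, which bounds
  the distance from below. Since the common orthogonal complement of the directions is the
  line through \<open>w\<close>, the part of a difference orthogonal to \<open>w\<close> lies in the sum of the direction
  spaces and can be removed by moving the two points, so the bound is attained.
\<close>

text \<open>The base index \<open>i\<close> is arbitrary because one face is based at
  \<open>v 0\<close> and the other at \<open>v n\<close>. An empty \<open>I\<close> covers a single
  vertex, where the span is \<open>{0}\<close>.\<close>

lemma affine_hull_image_eq_translate_span:
  fixes f :: "'i \<Rightarrow> 'a::real_vector"
  shows "affine hull (f ` insert i I) = (+) (f i) ` span {f j - f i |j. j \<in> I}"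
proof -
  have "(\<lambda>x. - f i + x) ` f ` I = {f j - f i |j. j \<in> I}"
    by (auto simp: image_iff)
  then show ?thesis
    using affine_hull_insert_span_gen[of "f i" "f ` I"] by simp
qed

text \<open>A subspace contained in another of the same finite dimension equals it.\<close>

lemma orthogonal_comp_eq_span_if_dim_1:
  fixes w :: "'a::euclidean_space"
  assumes "dim (U\<^sup>\<bottom>) = 1" "w \<in> U\<^sup>\<bottom>" "w \<noteq> 0"
  shows "U\<^sup>\<bottom> = span {w}"
proof (rule subspace_dim_equal[symmetric])
  show "span {w} \<subseteq> U\<^sup>\<bottom>"
    using assms(2) by (intro span_minimal) (auto simp: subspace_orthogonal_comp)
  show "dim (U\<^sup>\<bottom>) \<le> dim (span {w})"
    using assms by (simp add: dim_insert)
qed (auto simp: subspace_orthogonal_comp)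

text \<open>The simplex is gone: what matters is two affine subspaces whose directions have a single
  common normal line.\<close>

lemma alt_eq_abs_inner_normal:
  fixes a b w :: "'a::euclidean_space"
  assumes S: "affine hull S = (+) a ` U" and T: "affine hull T = (+) b ` W"
    and U: "subspace U" and W: "subspace W"
    and dim: "dim ((U + W)\<^sup>\<bottom>) = 1" and w: "w \<in> (U + W)\<^sup>\<bottom>" "w \<noteq> 0"
  shows "alt S T = \<bar>(a - b) \<bullet> (w /\<^sub>R norm w)\<bar>"
proof (rule antisym)
  have ne: "S \<noteq> {}" "T \<noteq> {}"
    using S T subspace_0[OF U] subspace_0[OF W] by auto
  have UW: "subspace (U + W)"
  proof -
    have "U + W = {x + y |x y. x \<in> U \<and> y \<in> W}"
      unfolding set_plus_def by auto
    then show ?thesis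
      using subspace_sums[OF U W] by simp
  qed
  have orth: "x \<bullet> w = 0" if "x \<in> U + W" for x
    using w(1) that by (auto simp: orthogonal_comp_def orthogonal_def)
  have U_orth: "x \<bullet> w = 0" if "x \<in> U" for x
    using orth[of "x + 0"] set_plus_intro[OF that subspace_0[OF W]] by simp
  have W_orth: "y \<bullet> w = 0" if "y \<in> W" for y
    using orth[of "0 + y"] set_plus_intro[OF subspace_0[OF U] that] by simp
  obtain u u' where u: "u \<in> affine hull S" "u' \<in> affine hull T" "alt S T = norm (u - u')"
    using alt_is_minimum(1)[OF ne] by blast
  then obtain x y where xy: "x \<in> U" "y \<in> W" "u = a + x" "u' = b + y"
    using S T by auto
  have "(a - b) \<bullet> w = (u - u') \<bullet> w"
    using U_orth[OF xy(1)] W_orth[OF xy(2)]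
    by (simp add: xy inner_diff_left inner_add_left)
  then show "\<bar>(a - b) \<bullet> (w /\<^sub>R norm w)\<bar> \<le> alt S T"
    using Cauchy_Schwarz_ineq2[of "u - u'" "w /\<^sub>R norm w"] w(2) u(3) by simp
  \<comment> \<open>\<open>c\<close> is the signed length of the component of \<open>a - b\<close>
    along \<open>w\<close>, so subtracting that component leaves a vector orthogonal to
    \<open>w\<close>.\<close>
  define c where "c = (a - b) \<bullet> (w /\<^sub>R norm w)"
  have "(a - b - c *\<^sub>R (w /\<^sub>R norm w)) \<bullet> w = 0"
    using w(2) by (simp add: c_def inner_diff_left dot_square_norm power2_eq_square inner_add_left field_simps)
  then have "a - b - c *\<^sub>R (w /\<^sub>R norm w) \<in> (span {w})\<^sup>\<bottom>"
    by (auto simp: orthogonal_comp_def orthogonal_def span_singleton inner_commute)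
  \<comment> \<open>\<open>(span {w})\<^sup>\<bottom>\<close> is the double complement of the
    subspace \<open>U + W\<close>, hence \<open>U + W\<close> itself.\<close>
  then have "a - b - c *\<^sub>R (w /\<^sub>R norm w) \<in> U + W"
    using orthogonal_comp_self[OF UW] orthogonal_comp_eq_span_if_dim_1[OF dim w] by simp
  then obtain x y where xy: "x \<in> U" "y \<in> W" "a - b - c *\<^sub>R (w /\<^sub>R norm w) = x + y"
    by (auto elim: set_plus_elim)
  \<comment> \<open>Moving \<open>a\<close> by \<open>- x\<close> and \<open>b\<close> by
    \<open>y\<close> cancels \<open>x + y\<close>, leaving a difference of norm
    \<open>\<bar>c\<bar>\<close>.\<close>
  have "a + - x \<in> affine hull S" "b + y \<in> affine hull T"
    unfolding S T using xy subspace_neg[OF U] by auto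
  then have "alt S T \<le> norm (a + - x - (b + y))"
    by (rule alt_is_minimum(2)[OF ne])
  also have "a + - x - (b + y) = c *\<^sub>R (w /\<^sub>R norm w)"
    using xy(3) by (simp add: algebra_simps)
  finally show "alt S T \<le> \<bar>(a - b) \<bullet> (w /\<^sub>R norm w)\<bar>"
    unfolding c_def[symmetric] using w(2) by (simp add: abs_mult field_simps)
qed

theorem lemma2:
  fixes v :: "nat \<Rightarrow> real ^ 'n" and n k :: nat
    and \<sigma> \<tau> \<tau>' V\<^sub>\<tau> V\<^sub>\<tau>' \<L> :: "(real ^ 'n) set"
  assumes "n = CARD('n)" and "n \<ge> 2"
    and "\<sigma> = v ` {0..n}" and "inj_on v {0..n}" and "\<not> affine_dependent \<sigma>"
    and "k \<le> n - 1"
    and "\<tau> = v ` {0..k}" and "\<tau>' = \<sigma> - \<tau>"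
    and "V\<^sub>\<tau> = span {v i - v 0 |i. i \<in> {1..k}}"
    and "V\<^sub>\<tau>' = span {v i - v n |i. i \<in> {k+1..n-1}}"
    and "\<L> = (V\<^sub>\<tau> + V\<^sub>\<tau>')\<^sup>\<bottom>"
  shows "\<forall>w \<in> \<L>. w \<noteq> 0 \<longrightarrow> alt \<tau> \<tau>' = \<bar>(v 0 - v n) \<bullet> (w /\<^sub>R norm w)\<bar>"
proof (intro ballI impI)
  fix w assume w: "w \<in> \<L>" "w \<noteq> 0"
  have "{0..k} = insert 0 {1..k}"
    by auto
  then have \<tau>: "affine hull \<tau> = (+) (v 0) ` V\<^sub>\<tau>"
    unfolding assms(7,9) by (simp only: affine_hull_image_eq_translate_span)
  have "\<tau>' = v ` ({0..n} - {0..k})"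
    unfolding assms(3,7,8) using assms(4,6)
    by (intro inj_on_image_set_diff[symmetric, where C = "{0..n}"]) auto
  \<comment> \<open>Since \<open>n\<close> is positive, the truncated bound
    \<open>k \<le> n - 1\<close> means \<open>k < n\<close>, so \<open>n\<close> survives as the
    base index.\<close>
  also have "{0..n} - {0..k} = insert n {k+1..n-1}"
    using assms(2,6) by auto
  finally have \<tau>': "affine hull \<tau>' = (+) (v n) ` V\<^sub>\<tau>'"
    unfolding assms(10) by (simp only: affine_hull_image_eq_translate_span)
  have "dim ((V\<^sub>\<tau> + V\<^sub>\<tau>')\<^sup>\<bottom>) = 1"
    unfolding assms(9,10)
    using dim_orthogonal_comp_opposite_faces assms(1,3-6) by blast
  then show "alt \<tau> \<tau>' = \<bar>(v 0 - v n) \<bullet> (w /\<^sub>R norm w)\<bar>"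
    using alt_eq_abs_inner_normal[OF \<tau> \<tau>'] w assms(9-11) by simp
qed

end
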